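(* Let $\mathcal{M}$ be a structure, $A\subseteq M$, $Q\in\{\forall,\exists\}$, $s\in\{\mathrm{sem},\mathrm{synt}\}$. Then the following assertions hold: 1. (Preservation of degrees of rigidity) If $A\subseteq\mathrm{dcl}(\emptyset)$ then $\deg^{Q\text{-}s}_{\mathrm{rig}}(\mathcal{M})=\deg^{Q\text{-}s}_{\mathrm{rig},A}(\mathcal{M})$. 2. (Rigiditization) If $A$ contains a witnessing set for the finite value $\deg^{\exists\text{-}s}_{\mathrm{rig}}(\mathcal{M})$ then $\deg^{\exists\text{-}s}_{\mathrm{rig},A}(\mathcal{M})=0$. 3. (Monotony) If $A\subseteq B\subseteq M$ then $\deg^{Q\text{-}s}_{\mathrm{rig},A}(\mathcal{M})\geq\deg^{Q\text{-}s}_{\mathrm{rig},B}(\mathcal{M})$. 4. (Additivity) If $A$ witnesses the finite value $\deg^{\exists\text{-}s}_{\mathrm{rig}}(\mathcal{M})$ then for any $A'\subseteq A$, $$\deg^{\exists\text{-}s}_{\mathrm{rig}}(\mathcal{M})=\deg^{\exists\text{-}s}_{\mathrm{rig},A'}(\mathcal{M})+\deg^{\exists\text{-}s}_{\mathrm{rig},A\setminus A'}(\mathcal{M}).$$ 5. (Cofinite character) If $A$ is cofinite in $\mathcal{M}$ then $\deg^{\exists\text{-}\mathrm{sem}}_{\mathrm{rig},A}(\mathcal{M})$ and $\deg^{\exists\text{-}\mathrm{synt}}_{\mathrm{rig},A}(\mathcal{M})$ are natural numbers (i.e., finite). 6. (Finite rigiditization) Any cofinite set $A$ in $\mathcal{M}$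 has a minimal finite extension $A'$ (i.e., $A'\supseteq A$ with $A'\setminus A$ finite) such that $\mathcal{M}_{A'}$ is semantically / syntactically rigid.
   Context: The universe of $\mathcal{M}$ is denoted $M$. For $A\subseteq M$, $\mathrm{dcl}(A)$ is the set of $b\in M$ such that $\{b\}$ is definable in $\mathcal{M}$ by a first-order formula with parameters from $A$. The structure $\mathcal{M}$ is semantically $A$-rigid if the only automorphism of $\mathcal{M}$ fixing $A$ pointwise is the identity; it is syntactically $A$-rigid if $M=\mathrm{dcl}(A)$. "Semantically rigid" and "syntactically rigid" mean the case $A=\emptyset$. For $n\in\omega$, $\mathcal{M}$ is $\forall$-semantically / $\forall$-syntactically (respectively $\exists$-semantically / $\exists$-syntactically) $n$-rigid if it is semantically / syntactically $A$-rigid for every (respectively some) $A\subseteq M$ with $|A|=n$. For $Q\in\{\forall,\exists\}$, $\deg^{Q\text{-}\mathrm{sem}}_{\mathrm{rig}}(\mathcal{M})$ (respectively $\deg^{Q\text{-}\mathrm{synt}}_{\mathrm{rig}}(\mathcal{M})$) is the least $n\in\omega$ such that $\mathcal{M}$ is $Q$-semantically (respectively $Q$-syntactically) $n$-rigid, and is $\infty$ if no such $n$ exists. A set $A$ witnesses the finite value $\deg^{\exists\text{-}s}_{\mathrm{rig}}(\mathcal{M})$ if $|A|$ equals this value and $\mathcal{M}$ is semantically $A$-rigid (for $s=\mathrm{sem}$), respectively syntactically $A$-rigid (for $s=\mathrm{synt}$). For $A\subseteq M$, $\mathcal{M}_A$ is the expansion of $\mathcal{M}$ by constants for all elements of $A$,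 and $\deg^{Q\text{-}s}_{\mathrm{rig},A}(\mathcal{M})$ is the least $n\in\omega$ such that $\mathcal{M}_A$ is $Q$-semantically (for $s=\mathrm{sem}$) / $Q$-syntactically (for $s=\mathrm{synt}$) $n$-rigid, and $\infty$ if no such $n$ exists. The order on $\omega\cup\{\infty\}$ has $n<\infty$ for all $n\in\omega$. *)

theory Defs
  imports Main "HOL-Library.Extended_Nat"
begin

section \<open>First-order structures\<close>

text \<open>
  A signature lists its symbols explicitly as sets, so that it may have no function symbols or no
  relation symbols; the arities of other elements of the types are irrelevant. Constants are
  function symbols of arity 0. A structure carries its signature.
\<close>

record ('f, 'r) signature =
  fsyms :: "'f set"
  farity :: "'f \<Rightarrow> nat"
  rsyms :: "'r set"
  rarity :: "'r \<Rightarrow> nat"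

record ('f, 'r, 'a) fo_struct = "('f, 'r) signature" +
  univ :: "'a set"
  ifun :: "'f \<Rightarrow> 'a list \<Rightarrow> 'a"
  irel :: "'r \<Rightarrow> 'a list \<Rightarrow> bool"

definition tuples :: "'a set \<Rightarrow> nat \<Rightarrow> 'a list set" where
  "tuples X n = {xs. set xs \<subseteq> X \<and> length xs = n}"

definition is_struct :: "('f, 'r, 'a) fo_struct \<Rightarrow> bool" where
  "is_struct M \<longleftrightarrow>
     univ M \<noteq> {} \<and> (\<forall>f\<in>fsyms M. \<forall>xs\<in>tuples (univ M) (farity M f). ifun M f xs \<in> univ M)"

datatype 'f tm = Var nat | Fun 'f "'f tm list"

datatype ('f, 'r) fm =
    Eq "'f tm" "'f tm"
  | Rel 'r "'f tm list"
  | Neg "('f, 'r) fm"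
  | Conj "('f, 'r) fm" "('f, 'r) fm"
  | Ex nat "('f, 'r) fm"

fun wf_tm :: "('f, 'r, 'z) signature_scheme \<Rightarrow> 'f tm \<Rightarrow> bool" where
  "wf_tm S (Var x) = True"
| "wf_tm S (Fun f ts) = (f \<in> fsyms S \<and> length ts = farity S f \<and> (\<forall>t\<in>set ts. wf_tm S t))"

fun wf_fm :: "('f, 'r, 'z) signature_scheme \<Rightarrow> ('f, 'r) fm \<Rightarrow> bool" where
  "wf_fm S (Eq t u) = (wf_tm S t \<and> wf_tm S u)"
| "wf_fm S (Rel r ts) = (r \<in> rsyms S \<and> length ts = rarity S r \<and> (\<forall>t\<in>set ts. wf_tm S t))"
| "wf_fm S (Neg \<phi>) = wf_fm S \<phi>"
| "wf_fm S (Conj \<phi> \<psi>) = (wf_fm S \<phi> \<and> wf_fm S \<psi>)"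
| "wf_fm S (Ex x \<phi>) = wf_fm S \<phi>"

fun fv_tm :: "'f tm \<Rightarrow> nat set" where
  "fv_tm (Var x) = {x}"
| "fv_tm (Fun f ts) = (\<Union>t\<in>set ts. fv_tm t)"

fun fv_fm :: "('f, 'r) fm \<Rightarrow> nat set" where
  "fv_fm (Eq t u) = fv_tm t \<union> fv_tm u"
| "fv_fm (Rel r ts) = (\<Union>t\<in>set ts. fv_tm t)"
| "fv_fm (Neg \<phi>) = fv_fm \<phi>"
| "fv_fm (Conj \<phi> \<psi>) = fv_fm \<phi> \<union> fv_fm \<psi>"
| "fv_fm (Ex x \<phi>) = fv_fm \<phi> - {x}"

fun eval :: "('f, 'r, 'a) fo_struct \<Rightarrow> (nat \<Rightarrow> 'a) \<Rightarrow> 'f tm \<Rightarrow> 'a" where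
  "eval M v (Var x) = v x"
| "eval M v (Fun f ts) = ifun M f (map (eval M v) ts)"

fun sat :: "('f, 'r, 'a) fo_struct \<Rightarrow> (nat \<Rightarrow> 'a) \<Rightarrow> ('f, 'r) fm \<Rightarrow> bool" where
  "sat M v (Eq t u) = (eval M v t = eval M v u)"
| "sat M v (Rel r ts) = irel M r (map (eval M v) ts)"
| "sat M v (Neg \<phi>) = (\<not> sat M v \<phi>)"
| "sat M v (Conj \<phi> \<psi>) = (sat M v \<phi> \<and> sat M v \<psi>)"
| "sat M v (Ex x \<phi>) = (\<exists>a\<in>univ M. sat M (v(x := a)) \<phi>)"

text \<open>
  Definability of a subset \<open>D\<close> of the universe with parameters from \<open>A\<close>: in the defining formula
  the variable 0 is the object variable, and the assignment \<open>v\<close> supplies the parameters for all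
  other free variables.
\<close>

definition definable :: "('f, 'r, 'a) fo_struct \<Rightarrow> 'a set \<Rightarrow> 'a set \<Rightarrow> bool" where
  "definable M A D \<longleftrightarrow>
     (\<exists>\<phi> v. wf_fm M \<phi> \<and> v ` (fv_fm \<phi> - {0}) \<subseteq> A \<and> D = {c \<in> univ M. sat M (v(0 := c)) \<phi>})"

definition dcl :: "('f, 'r, 'a) fo_struct \<Rightarrow> 'a set \<Rightarrow> 'a set" where
  "dcl M A = {b \<in> univ M. definable M A {b}}"

text \<open>Only the values of an automorphism on the universe matter.\<close>

definition automorphism :: "('f, 'r, 'a) fo_struct \<Rightarrow> ('a \<Rightarrow> 'a) \<Rightarrow> bool" where
  "automorphism M h \<longleftrightarrow>
     bij_betw h (univ M) (univ M) \<and>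
     (\<forall>f\<in>fsyms M. \<forall>xs\<in>tuples (univ M) (farity M f). h (ifun M f xs) = ifun M f (map h xs)) \<and>
     (\<forall>r\<in>rsyms M. \<forall>xs\<in>tuples (univ M) (rarity M r). irel M r xs \<longleftrightarrow> irel M r (map h xs))"

text \<open>The expansion by constants: the new constant symbol for \<open>a \<in> A\<close> is \<open>Inr a\<close>.\<close>

definition expand :: "('f, 'r, 'a) fo_struct \<Rightarrow> 'a set \<Rightarrow> ('f + 'a, 'r, 'a) fo_struct" where
  "expand M A =
     \<lparr>fsyms = Inl ` fsyms M \<union> Inr ` A,
      farity = case_sum (farity M) (\<lambda>a. 0),
      rsyms = rsyms M,
      rarity = rarity M,
      univ = univ M,
      ifun = case_sum (ifun M) (\<lambda>a xs. a),
      irel = irel M\<rparr>"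

section \<open>Rigidity\<close>

definition sem_rigid :: "('f, 'r, 'a) fo_struct \<Rightarrow> 'a set \<Rightarrow> bool" where
  "sem_rigid M A \<longleftrightarrow>
     (\<forall>h. automorphism M h \<and> (\<forall>a\<in>A. h a = a) \<longrightarrow> (\<forall>x\<in>univ M. h x = x))"

definition synt_rigid :: "('f, 'r, 'a) fo_struct \<Rightarrow> 'a set \<Rightarrow> bool" where
  "synt_rigid M A \<longleftrightarrow> univ M = dcl M A"

datatype rig_mode = Sem | Synt

datatype rig_quant = QForall | QExists

fun rigid_over :: "rig_mode \<Rightarrow> ('f, 'r, 'a) fo_struct \<Rightarrow> 'a set \<Rightarrow> bool" where
  "rigid_over Sem M A = sem_rigid M A"
| "rigid_over Synt M A = synt_rigid M A"

abbreviation rigid :: "rig_mode \<Rightarrow> ('f, 'r, 'a) fo_struct \<Rightarrow> bool" where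
  "rigid s M \<equiv> rigid_over s M {}"

fun n_rigid :: "rig_quant \<Rightarrow> rig_mode \<Rightarrow> ('f, 'r, 'a) fo_struct \<Rightarrow> nat \<Rightarrow> bool" where
  "n_rigid QForall s M n = (\<forall>A. A \<subseteq> univ M \<and> finite A \<and> card A = n \<longrightarrow> rigid_over s M A)"
| "n_rigid QExists s M n = (\<exists>A. A \<subseteq> univ M \<and> finite A \<and> card A = n \<and> rigid_over s M A)"

definition deg_rig :: "rig_quant \<Rightarrow> rig_mode \<Rightarrow> ('f, 'r, 'a) fo_struct \<Rightarrow> enat" where
  "deg_rig Q s M = (if \<exists>n. n_rigid Q s M n then enat (LEAST n. n_rigid Q s M n) else \<infinity>)"

definition deg_rig_over ::
    "rig_quant \<Rightarrow> rig_mode \<Rightarrow> ('f, 'r, 'a) fo_struct \<Rightarrow> 'a set \<Rightarrow> enat" where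
  "deg_rig_over Q s M A = deg_rig Q s (expand M A)"

definition witnesses :: "rig_mode \<Rightarrow> ('f, 'r, 'a) fo_struct \<Rightarrow> 'a set \<Rightarrow> bool" where
  "witnesses s M A \<longleftrightarrow>
     A \<subseteq> univ M \<and> finite A \<and> deg_rig QExists s M = enat (card A) \<and> rigid_over s M A"

text \<open>\<open>A'\<close> is a minimal (with respect to inclusion) finite extension of \<open>A\<close> for which the
  expansion of \<open>M\<close> by constants is rigid.\<close>

definition minimal_rigid_ext ::
    "rig_mode \<Rightarrow> ('f, 'r, 'a) fo_struct \<Rightarrow> 'a set \<Rightarrow> 'a set \<Rightarrow> bool" where
  "minimal_rigid_ext s M A A' \<longleftrightarrow>
     A \<subseteq> A' \<and> A' \<subseteq> univ M \<and> finite (A' - A) \<and> rigid s (expand M A') \<and>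
     (\<forall>A''. A \<subseteq> A'' \<and> A'' \<subset> A' \<longrightarrow> \<not> rigid s (expand M A''))"

end

theory Submission
  imports Defs
begin

text \<open>
  Everything rests on one principle: an expansion by constants for \<open>A\<close> turns the elements of \<open>A\<close>
  into parameters that are always available, so that \<^term>\<open>expand M A\<close> is rigid over \<open>C\<close> exactly
  when \<open>M\<close> is rigid over \<open>A \<union> C\<close> (lemma \<open>rigid_over_expand\<close>).
  Semantically this holds because the automorphisms of the expansion are the automorphisms of \<open>M\<close>
  that fix \<open>A\<close>. Syntactically it says that \<open>dcl\<close> of \<open>C\<close> in the expansion is \<open>dcl\<close> of \<open>A \<union> C\<close>
  in \<open>M\<close>: constants can be replaced by parameters in fresh variables, and conversely a parameter
  in \<open>A\<close> is definable without parameters in the expansion and can therefore be quantified away.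

  Since rigidity over a set passes to larger sets, the degree over \<open>A\<close> becomes the combinatorial
  question of how many further points are needed beyond \<open>A\<close>. Monotony, rigiditization, and the two
  assertions on cofinite sets follow at once, the latter because \<open>M\<close> is rigid over its whole
  universe and a finite family of sets has a minimal member. For additivity, a witness \<open>W\<close>
  has the least cardinality among finite sets over which \<open>M\<close> is rigid; so beyond
  \<open>A' \<subseteq> W\<close> exactly \<open>card (W - A')\<close> points are needed, and beyond \<open>W - A'\<close> exactly \<open>card A'\<close>.
  Preservation of degrees holds because elements of \<open>dcl M {}\<close> contribute nothing as parameters:
  automorphisms fix them, and definitions using them can be rewritten without them
  (lemma \<open>rigid_over_Un_dcl_empty\<close>).
\<close>

section \<open>Satisfaction, automorphisms and parameter-free definability\<close>

lemma eval_cong: "(\<And>x. x \<in> fv_tm t \<Longrightarrow> v x = w x) \<Longrightarrow> eval M v t = eval M w t"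
proof (induction t)
  case (Fun f ts)
  then have "map (eval M v) ts = map (eval M w) ts" by auto
  then show ?case by (simp only: eval.simps)
qed simp

lemma sat_cong: "(\<And>x. x \<in> fv_fm \<phi> \<Longrightarrow> v x = w x) \<Longrightarrow> sat M v \<phi> = sat M w \<phi>"
proof (induction \<phi> arbitrary: v w)
  case (Eq t u)
  then show ?case using eval_cong[of t v w M] eval_cong[of u v w M] by simp
next
  case (Rel r ts)
  then have "map (eval M v) ts = map (eval M w) ts" by (auto intro!: eval_cong)
  then show ?case by (simp only: sat.simps)
next
  case (Neg \<phi>)
  then show ?case by (metis fv_fm.simps(3) sat.simps(3))
next
  case (Conj \<phi> \<psi>)
  then show ?case by (metis UnCI fv_fm.simps(4) sat.simps(4))
next
  case (Ex x \<phi>)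
  have "sat M (v(x := a)) \<phi> = sat M (w(x := a)) \<phi>" for a
    by (rule Ex.IH) (use Ex.prems in auto)
  then show ?case by simp
qed

lemma eval_in_univ:
  assumes "is_struct M" "range v \<subseteq> univ M"
  shows "wf_tm M t \<Longrightarrow> eval M v t \<in> univ M"
proof (induction t)
  case (Var x)
  then show ?case using assms(2) by auto
next
  case (Fun f ts)
  then have "map (eval M v) ts \<in> tuples (univ M) (farity M f)"
    by (auto simp: tuples_def)
  then show ?case using Fun.prems assms(1) by (auto simp: is_struct_def)
qed

lemma map_eval_in_tuples:
  assumes "is_struct M" "range v \<subseteq> univ M" "\<forall>t\<in>set ts. wf_tm M t"
  shows "map (eval M v) ts \<in> tuples (univ M) (length ts)"
  using assms eval_in_univ[OF assms(1,2)] by (auto simp: tuples_def)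

lemma automorphism_eval:
  assumes "is_struct M" "automorphism M h" "range v \<subseteq> univ M"
  shows "wf_tm M t \<Longrightarrow> eval M (\<lambda>x. h (v x)) t = h (eval M v t)"
proof (induction t)
  case (Fun f ts)
  have "map (eval M (\<lambda>x. h (v x))) ts = map h (map (eval M v) ts)"
    using Fun by auto
  moreover have "map (eval M v) ts \<in> tuples (univ M) (farity M f)"
    using map_eval_in_tuples[OF assms(1,3), of ts] Fun.prems by simp
  ultimately show ?case
    using Fun.prems assms(2) by (simp add: automorphism_def del: map_map)
qed simp

lemma automorphism_sat:
  assumes "is_struct M" "automorphism M h"
  shows "wf_fm M \<phi> \<Longrightarrow> range v \<subseteq> univ M \<Longrightarrow> sat M (\<lambda>x. h (v x)) \<phi> = sat M v \<phi>"
proof (induction \<phi> arbitrary: v)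
  case (Eq t u)
  have "inj_on h (univ M)" using assms(2) by (simp add: automorphism_def bij_betw_def)
  then show ?case
    using Eq automorphism_eval[OF assms Eq.prems(2)] eval_in_univ[OF assms(1) Eq.prems(2)]
    by (auto dest: inj_onD)
next
  case (Rel r ts)
  have "map (eval M (\<lambda>x. h (v x))) ts = map h (map (eval M v) ts)"
    using Rel automorphism_eval[OF assms Rel.prems(2)] by auto
  moreover have "map (eval M v) ts \<in> tuples (univ M) (rarity M r)"
    using map_eval_in_tuples[OF assms(1) Rel.prems(2), of ts] Rel.prems(1) by simp
  ultimately show ?case
    using Rel.prems(1) assms(2) by (simp add: automorphism_def del: map_map)
next
  case (Ex x \<phi>)
  have *: "sat M ((\<lambda>y. h (v y))(x := h a)) \<phi> = sat M (v(x := a)) \<phi>" if "a \<in> univ M" for a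
  proof -
    have "(\<lambda>y. h (v y))(x := h a) = (\<lambda>y. h ((v(x := a)) y))" by auto
    moreover have "range (v(x := a)) \<subseteq> univ M" using Ex.prems(2) that by auto
    moreover have "wf_fm M \<phi>" using Ex.prems(1) by simp
    ultimately show ?thesis using Ex.IH[of "v(x := a)"] by metis
  qed
  have "h ` univ M = univ M" using assms(2) by (simp add: automorphism_def bij_betw_def)
  then have "(\<exists>b\<in>univ M. sat M ((\<lambda>y. h (v y))(x := b)) \<phi>)
      \<longleftrightarrow> (\<exists>a\<in>univ M. sat M ((\<lambda>y. h (v y))(x := h a)) \<phi>)"
    by (metis (no_types, lifting) imageE imageI)
  then show ?case using * by auto
qed auto

lemma mem_dcl_empty:
  assumes "b \<in> dcl M {}"
  shows "\<exists>\<delta>. wf_fm M \<delta> \<and> fv_fm \<delta> \<subseteq> {0} \<and> (\<forall>v. v 0 \<in> univ M \<longrightarrow> sat M v \<delta> = (v 0 = b))"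
proof -
  obtain \<delta> w where wf: "wf_fm M \<delta>" and fv: "w ` (fv_fm \<delta> - {0}) \<subseteq> {}"
    and b: "{b} = {c \<in> univ M. sat M (w(0 := c)) \<delta>}"
    using assms by (auto simp: dcl_def definable_def)
  have fv': "fv_fm \<delta> \<subseteq> {0}" using fv by auto
  have "sat M v \<delta> \<longleftrightarrow> v 0 = b" if "v 0 \<in> univ M" for v
  proof -
    have "sat M v \<delta> = sat M (w(0 := v 0)) \<delta>"
      by (rule sat_cong) (use fv' in auto)
    then show ?thesis using b that by auto
  qed
  with wf fv' show ?thesis by blast
qed

lemma automorphism_fixes_dcl_empty:
  assumes "is_struct M" "automorphism M h" "b \<in> dcl M {}"
  shows "h b = b"
proof -
  obtain \<delta> where wf: "wf_fm M \<delta>"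
    and sat: "\<And>v. v 0 \<in> univ M \<Longrightarrow> sat M v \<delta> \<longleftrightarrow> v 0 = b"
    using mem_dcl_empty[OF assms(3)] by blast
  have b: "b \<in> univ M" using assms(3) by (simp add: dcl_def)
  then have hb: "h b \<in> univ M" using assms(2) by (auto simp: automorphism_def bij_betw_def)
  have "sat M (\<lambda>_. h b) \<delta>"
    using automorphism_sat[OF assms(1,2) wf, of "\<lambda>_. b"] sat[of "\<lambda>_. b"] b by auto
  then show ?thesis using sat[of "\<lambda>_. h b"] hb by simp
qed

lemma dcl_mono: "A \<subseteq> B \<Longrightarrow> dcl M A \<subseteq> dcl M B"
  unfolding dcl_def definable_def by blast

text \<open>
  If the value of the parameter \<open>x\<close> is defined by \<open>\<delta>\<close>, then \<open>\<phi>\<close> may be replaced by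
  \<open>\<exists>x. \<phi> \<and> \<delta>(x)\<close>, which has one parameter less. As \<open>\<delta>\<close> speaks about the variable 0, the formula
  \<open>\<delta>(x)\<close> is written as \<open>\<exists>0. 0 = x \<and> \<delta>\<close>, which avoids any substitution. Doing this for one
  parameter after the other removes all parameters from \<open>dcl M {}\<close>.
\<close>

lemma dcl_Un_dcl_empty:
  assumes A: "A \<subseteq> dcl M {}"
  shows "dcl M (A \<union> B) = dcl M B"
proof
  have eliminate: "\<exists>\<psi>. wf_fm M \<psi> \<and> v ` (fv_fm \<psi> - {0}) \<subseteq> B \<and>
      (\<forall>c\<in>univ M. sat M (v(0 := c)) \<psi> = sat M (v(0 := c)) \<phi>)"
    if "finite X" "wf_fm M \<phi>" "v ` (fv_fm \<phi> - {0} - X) \<subseteq> B" "v ` X \<subseteq> A" "0 \<notin> X"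
    for X \<phi> v
    using that
  proof (induction X arbitrary: \<phi> rule: finite_induct)
    case empty
    then show ?case by auto
  next
    case (insert x X)
    have x: "v x \<in> dcl M {}" "v x \<in> univ M" "x \<noteq> 0"
      using insert.prems A by (auto simp: dcl_def)
    obtain \<delta> where wf: "wf_fm M \<delta>" and fv: "fv_fm \<delta> \<subseteq> {0}"
      and sat: "\<And>w. w 0 \<in> univ M \<Longrightarrow> sat M w \<delta> \<longleftrightarrow> w 0 = v x"
      using mem_dcl_empty[OF x(1)] by blast
    define \<phi>' where
      "\<phi>' = Ex x (Conj \<phi> (Ex 0 (Conj (Eq (Var 0) (Var x)) \<delta>)))"
    have "sat M (v(0 := c)) \<phi>' = sat M (v(0 := c)) \<phi>" for c
    proof -
      have "sat M (v(0 := c)) \<phi>' \<longleftrightarrow> sat M (v(0 := c, x := v x)) \<phi>"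
        using x(2,3) sat unfolding \<phi>'_def by auto
      also have "v(0 := c, x := v x) = v(0 := c)" using x(3) by auto
      finally show ?thesis .
    qed
    moreover have "wf_fm M \<phi>'" using wf insert.prems(1) by (simp add: \<phi>'_def)
    moreover have "v ` (fv_fm \<phi>' - {0} - X) \<subseteq> B"
      using insert.prems(2) fv by (auto simp: \<phi>'_def)
    moreover have "v ` X \<subseteq> A" "0 \<notin> X" using insert.prems by auto
    ultimately show ?case using insert.IH[of \<phi>'] by metis
  qed
  have finite_fv_tm: "finite (fv_tm t)" for t :: "'f tm"
    by (induction t) auto
  have finite_fv: "finite (fv_fm \<phi>)" for \<phi> :: "('f, 'r) fm"
    by (induction \<phi>) (auto simp: finite_fv_tm)
  show "dcl M (A \<union> B) \<subseteq> dcl M B"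
  proof
    fix b assume "b \<in> dcl M (A \<union> B)"
    then obtain \<phi> v where b: "b \<in> univ M" and wf: "wf_fm M \<phi>"
      and v: "v ` (fv_fm \<phi> - {0}) \<subseteq> A \<union> B"
      and eq: "{b} = {c \<in> univ M. sat M (v(0 := c)) \<phi>}"
      by (auto simp: dcl_def definable_def)
    obtain \<psi> where "wf_fm M \<psi>" "v ` (fv_fm \<psi> - {0}) \<subseteq> B"
      and "\<forall>c\<in>univ M. sat M (v(0 := c)) \<psi> = sat M (v(0 := c)) \<phi>"
    proof -
      let ?X = "{x \<in> fv_fm \<phi> - {0}. v x \<in> A}"
      have "v ` (fv_fm \<phi> - {0} - ?X) \<subseteq> B" using v by auto
      moreover have "finite ?X" "v ` ?X \<subseteq> A" "0 \<notin> ?X" using finite_fv[of \<phi>] by auto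
      ultimately show ?thesis using eliminate[of ?X \<phi> v] wf that by blast
    qed
    then have "wf_fm M \<psi> \<and> v ` (fv_fm \<psi> - {0}) \<subseteq> B \<and> {b} = {c \<in> univ M. sat M (v(0 := c)) \<psi>}"
      using eq by auto
    then show "b \<in> dcl M B" using b unfolding dcl_def definable_def by blast
  qed
  show "dcl M B \<subseteq> dcl M (A \<union> B)" by (rule dcl_mono) simp
qed

section \<open>Replacing constants by parameters\<close>

text \<open>
  The constant \<open>Inr a\<close> becomes the variable \<open>2 * k a + 1\<close>, while the variables of the formula move
  to even numbers. So no quantifier captures a constant, and the object variable 0 stays in place.
\<close>

fun consts_to_vars_tm :: "('a \<Rightarrow> nat) \<Rightarrow> ('f + 'a) tm \<Rightarrow> 'f tm" where
  "consts_to_vars_tm k (Var x) = Var (2 * x)"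
| "consts_to_vars_tm k (Fun (Inl f) ts) = Fun f (map (consts_to_vars_tm k) ts)"
| "consts_to_vars_tm k (Fun (Inr a) ts) = Var (2 * k a + 1)"

fun consts_to_vars :: "('a \<Rightarrow> nat) \<Rightarrow> ('f + 'a, 'r) fm \<Rightarrow> ('f, 'r) fm" where
  "consts_to_vars k (Eq t u) = Eq (consts_to_vars_tm k t) (consts_to_vars_tm k u)"
| "consts_to_vars k (Rel r ts) = Rel r (map (consts_to_vars_tm k) ts)"
| "consts_to_vars k (Neg \<phi>) = Neg (consts_to_vars k \<phi>)"
| "consts_to_vars k (Conj \<phi> \<psi>) = Conj (consts_to_vars k \<phi>) (consts_to_vars k \<psi>)"
| "consts_to_vars k (Ex x \<phi>) = Ex (2 * x) (consts_to_vars k \<phi>)"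

lemma expand_simps [simp]:
  "fsyms (expand M A) = Inl ` fsyms M \<union> Inr ` A"
  "farity (expand M A) = case_sum (farity M) (\<lambda>a. 0)"
  "rsyms (expand M A) = rsyms M"
  "rarity (expand M A) = rarity M"
  "univ (expand M A) = univ M"
  "ifun (expand M A) = case_sum (ifun M) (\<lambda>a xs. a)"
  "irel (expand M A) = irel M"
  by (simp_all add: expand_def)

lemma wf_consts_to_vars_tm: "wf_tm (expand M A) t \<Longrightarrow> wf_tm M (consts_to_vars_tm k t)"
  by (induction k t rule: consts_to_vars_tm.induct) auto

lemma wf_consts_to_vars: "wf_fm (expand M A) \<phi> \<Longrightarrow> wf_fm M (consts_to_vars k \<phi>)"
  by (induction \<phi>) (auto simp: wf_consts_to_vars_tm)

lemma fv_consts_to_vars_tm: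
  "n \<in> fv_tm (consts_to_vars_tm k t)
    \<Longrightarrow> (\<exists>x\<in>fv_tm t. n = 2 * x) \<or> (\<exists>a. Inr a \<in> set_tm t \<and> n = 2 * k a + 1)"
proof (induction k t rule: consts_to_vars_tm.induct)
  case (2 k f ts)
  then obtain t where "t \<in> set ts" "n \<in> fv_tm (consts_to_vars_tm k t)" by auto
  with 2(1)[of t] have "(\<exists>x\<in>fv_tm t. n = 2 * x) \<or> (\<exists>a. Inr a \<in> set_tm t \<and> n = 2 * k a + 1)"
    by simp
  moreover have "fv_tm t \<subseteq> fv_tm (Fun (Inl f) ts)" "set_tm t \<subseteq> set_tm (Fun (Inl f) ts)"
    using \<open>t \<in> set ts\<close> by auto
  ultimately show ?case by blast
next
  case (3 k a ts)
  have "Inr a \<in> set_tm (Fun (Inr a) ts)" by simp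
  moreover have "n = 2 * k a + 1" using 3 by simp
  ultimately show ?case by blast
qed simp

lemma fv_consts_to_vars:
  "n \<in> fv_fm (consts_to_vars k \<phi>)
    \<Longrightarrow> (\<exists>x\<in>fv_fm \<phi>. n = 2 * x) \<or> (\<exists>a. Inr a \<in> set1_fm \<phi> \<and> n = 2 * k a + 1)"
proof (induction \<phi>)
  case (Eq t u)
  then have "n \<in> fv_tm (consts_to_vars_tm k t) \<or> n \<in> fv_tm (consts_to_vars_tm k u)" by simp
  then show ?case
    using fv_consts_to_vars_tm[of n k t] fv_consts_to_vars_tm[of n k u]
    by (simp only: fv_fm.simps fm.set) blast
next
  case (Rel r ts)
  then obtain t where "t \<in> set ts" "n \<in> fv_tm (consts_to_vars_tm k t)" by auto
  then show ?case
    using fv_consts_to_vars_tm[of n k t] by (simp only: fv_fm.simps fm.set) blast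
next
  case (Neg \<phi>)
  then show ?case by simp
next
  case (Conj \<phi> \<psi>)
  then have "n \<in> fv_fm (consts_to_vars k \<phi>) \<or> n \<in> fv_fm (consts_to_vars k \<psi>)" by simp
  then show ?case using Conj.IH by (simp only: fv_fm.simps fm.set) blast
next
  case (Ex x \<phi>)
  then have "n \<in> fv_fm (consts_to_vars k \<phi>)" "n \<noteq> 2 * x" by simp_all
  then show ?case using Ex.IH by (simp only: fv_fm.simps fm.set) blast
qed

lemma eval_consts_to_vars_tm:
  assumes "\<And>x. u (2 * x) = v x"
  shows "(\<And>a. Inr a \<in> set_tm t \<Longrightarrow> u (2 * k a + 1) = a)
    \<Longrightarrow> eval M u (consts_to_vars_tm k t) = eval (expand M A) v t"
proof (induction k t rule: consts_to_vars_tm.induct)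
  case (2 k f ts)
  have "eval M u (consts_to_vars_tm k t) = eval (expand M A) v t" if "t \<in> set ts" for t
    by (rule 2(1)[OF that]) (rule 2(2), use that in auto)
  then have "map (eval M u) (map (consts_to_vars_tm k) ts) = map (eval (expand M A) v) ts"
    by auto
  then show ?case by (simp del: map_map)
next
  case (3 k a ts)
  have "u (2 * k a + 1) = a" by (rule 3) simp
  then show ?case by simp
qed (simp add: assms)

lemma sat_consts_to_vars:
  "(\<And>x. u (2 * x) = v x) \<Longrightarrow> (\<And>a. Inr a \<in> set1_fm \<phi> \<Longrightarrow> u (2 * k a + 1) = a)
    \<Longrightarrow> sat M u (consts_to_vars k \<phi>) = sat (expand M A) v \<phi>"
proof (induction \<phi> arbitrary: u v)
  case (Eq t s)
  have "eval M u (consts_to_vars_tm k t) = eval (expand M A) v t"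
    using Eq(1) by (rule eval_consts_to_vars_tm) (rule Eq(2), simp)
  moreover have "eval M u (consts_to_vars_tm k s) = eval (expand M A) v s"
    using Eq(1) by (rule eval_consts_to_vars_tm) (rule Eq(2), simp)
  ultimately show ?case by (simp only: consts_to_vars.simps sat.simps)
next
  case (Rel r ts)
  have "eval M u (consts_to_vars_tm k t) = eval (expand M A) v t" if "t \<in> set ts" for t
    using Rel(1) by (rule eval_consts_to_vars_tm) (rule Rel(2), use that in auto)
  then have "map (eval M u) (map (consts_to_vars_tm k) ts) = map (eval (expand M A) v) ts"
    by simp
  then show ?case by (simp del: map_map)
next
  case (Neg \<phi>)
  have "sat M u (consts_to_vars k \<phi>) = sat (expand M A) v \<phi>"
    by (rule Neg.IH) (use Neg.prems in auto)
  then show ?case by simp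
next
  case (Conj \<phi> \<psi>)
  have "sat M u (consts_to_vars k \<phi>) = sat (expand M A) v \<phi>"
    by (rule Conj.IH(1)) (use Conj.prems in auto)
  moreover have "sat M u (consts_to_vars k \<psi>) = sat (expand M A) v \<psi>"
    by (rule Conj.IH(2)) (use Conj.prems in auto)
  ultimately show ?case by simp
next
  case (Ex x \<phi>)
  have "sat M (u(2 * x := b)) (consts_to_vars k \<phi>) = sat (expand M A) (v(x := b)) \<phi>" for b
  proof (rule Ex.IH)
    show "(u(2 * x := b)) (2 * k a + 1) = a" if "Inr a \<in> set1_fm \<phi>" for a
    proof -
      have "2 * k a + 1 \<noteq> 2 * x" by presburger
      then show ?thesis using Ex.prems(2)[of a] that by simp
    qed
  qed (use Ex.prems(1) in auto)
  then show ?case by simp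
qed

lemma wf_consts_tm: "wf_tm (expand M A) t \<Longrightarrow> Inr -` set_tm t \<subseteq> A"
  by (induction t) auto

lemma wf_consts: "wf_fm (expand M A) \<phi> \<Longrightarrow> Inr -` set1_fm \<phi> \<subseteq> A"
proof (induction \<phi>)
  case (Eq t u)
  then show ?case using wf_consts_tm[of M A t] wf_consts_tm[of M A u] by auto
next
  case (Rel r ts)
  then show ?case using wf_consts_tm[of M A] by fastforce
qed auto

lemma finite_set1_fm: "finite (set1_fm \<phi>)"
proof -
  have "finite (set_tm t)" for t :: "'c tm" by (induction t) auto
  then show ?thesis by (induction \<phi>) auto
qed

lemma dcl_expand_subset: "dcl (expand M A) C \<subseteq> dcl M (A \<union> C)"
proof
  fix b assume "b \<in> dcl (expand M A) C"
  then have b: "b \<in> univ M" and "definable (expand M A) C {b}"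
    by (simp_all add: dcl_def)
  from this(2) obtain \<phi> v where wf: "wf_fm (expand M A) \<phi>"
    and v: "v ` (fv_fm \<phi> - {0}) \<subseteq> C"
    and eq: "{b} = {c \<in> univ M. sat (expand M A) (v(0 := c)) \<phi>}"
    unfolding definable_def expand_simps by (elim exE conjE)
  define K where "K = Inr -` set1_fm \<phi>"
  have "finite K" unfolding K_def by (rule finite_vimageI[OF finite_set1_fm]) simp
  then obtain k :: "_ \<Rightarrow> nat" where k: "inj_on k K"
    using finite_imp_inj_to_nat_seg[of K] by auto
  define u where "u n = (if even n then v (n div 2) else inv_into K k (n div 2))" for n
  have u_const: "u (2 * k a + 1) = a" if "a \<in> K" for a
    unfolding u_def using inv_into_f_f[OF k that] by simp
  have "sat M (u(0 := c)) (consts_to_vars k \<phi>) = sat (expand M A) (v(0 := c)) \<phi>" for c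
  proof (rule sat_consts_to_vars)
    show "(u(0 := c)) (2 * x) = (v(0 := c)) x" for x by (simp add: u_def)
    show "(u(0 := c)) (2 * k a + 1) = a" if "Inr a \<in> set1_fm \<phi>" for a
      using u_const[of a] that by (simp add: K_def)
  qed
  then have "{b} = {c \<in> univ M. sat M (u(0 := c)) (consts_to_vars k \<phi>)}"
    using eq by (simp only:)
  moreover have "u ` (fv_fm (consts_to_vars k \<phi>) - {0}) \<subseteq> A \<union> C"
  proof -
    have "u ` (fv_fm (consts_to_vars k \<phi>) - {0}) \<subseteq> K \<union> v ` (fv_fm \<phi> - {0})"
    proof
      fix y assume "y \<in> u ` (fv_fm (consts_to_vars k \<phi>) - {0})"
      then obtain n where n: "n \<in> fv_fm (consts_to_vars k \<phi>)" "n \<noteq> 0" "y = u n" by auto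
      then consider x where "x \<in> fv_fm \<phi>" "n = 2 * x" | a where "a \<in> K" "n = 2 * k a + 1"
        using fv_consts_to_vars[of n k \<phi>] unfolding K_def by blast
      then show "y \<in> K \<union> v ` (fv_fm \<phi> - {0})"
      proof cases
        case 1
        then show ?thesis using n(2,3) by (auto simp: u_def)
      next
        case 2
        then show ?thesis using n(3) u_const by simp
      qed
    qed
    also have "\<dots> \<subseteq> A \<union> C" using v wf_consts[OF wf] unfolding K_def by (intro Un_mono) auto
    finally show ?thesis .
  qed
  ultimately have "definable M (A \<union> C) {b}"
    using wf_consts_to_vars[OF wf, of k] unfolding definable_def by (intro exI conjI)
  then show "b \<in> dcl M (A \<union> C)" using b by (simp add: dcl_def)
qed

section \<open>Replacing parameters by constants\<close>

lemma wf_map_Inl_tm: "wf_tm M t \<Longrightarrow> wf_tm (expand M A) (map_tm Inl t)"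
  by (induction t) auto

lemma wf_map_Inl: "wf_fm M \<phi> \<Longrightarrow> wf_fm (expand M A) (map_fm Inl id \<phi>)"
  by (induction \<phi>) (auto simp: wf_map_Inl_tm)

lemma fv_map_Inl_tm: "fv_tm (map_tm Inl t) = fv_tm t"
  by (induction t) auto

lemma fv_map_Inl: "fv_fm (map_fm Inl id \<phi>) = fv_fm \<phi>"
  by (induction \<phi>) (auto simp: fv_map_Inl_tm)

lemma eval_map_Inl: "eval (expand M A) v (map_tm Inl t) = eval M v t"
proof (induction t)
  case (Fun f ts)
  then have "map (eval (expand M A) v) (map (map_tm Inl) ts) = map (eval M v) ts" by auto
  then show ?case by (simp del: map_map)
qed simp

lemma sat_map_Inl: "sat (expand M A) v (map_fm Inl id \<phi>) = sat M v \<phi>"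
  by (induction \<phi> arbitrary: v) (simp_all add: eval_map_Inl comp_def)

lemma dcl_subset_dcl_expand: "dcl M B \<subseteq> dcl (expand M A) B"
proof
  fix b assume "b \<in> dcl M B"
  then obtain \<phi> v where b: "b \<in> univ M" and "wf_fm M \<phi>" "v ` (fv_fm \<phi> - {0}) \<subseteq> B"
    "{b} = {c \<in> univ M. sat M (v(0 := c)) \<phi>}"
    by (auto simp: dcl_def definable_def)
  then have "wf_fm (expand M A) (map_fm Inl id \<phi>) \<and> v ` (fv_fm (map_fm Inl id \<phi>) - {0}) \<subseteq> B \<and>
      {b} = {c \<in> univ (expand M A). sat (expand M A) (v(0 := c)) (map_fm Inl id \<phi>)}"
    by (simp only: wf_map_Inl fv_map_Inl sat_map_Inl expand_simps simp_thms)
  then have "definable (expand M A) B {b}" unfolding definable_def by (intro exI)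
  then show "b \<in> dcl (expand M A) B" using b by (simp add: dcl_def)
qed

lemma constants_in_dcl_empty:
  assumes "A \<subseteq> univ M"
  shows "A \<subseteq> dcl (expand M A) {}"
proof
  fix a assume "a \<in> A"
  then show "a \<in> dcl (expand M A) {}"
    using assms unfolding dcl_def definable_def
    by (auto intro!: exI[of _ "Eq (Var 0) (Fun (Inr a) [])"])
qed

text \<open>
  A formula over \<open>M\<close> stays meaningful in the expansion, with its parameters from \<open>A \<union> C\<close>; those in
  \<open>A\<close> lie in \<open>dcl (expand M A) {}\<close>, so the elimination of parameters applied in the
  expansion leaves only those in \<open>C\<close>. The converse inclusion is the translation of constants into
  variables.
\<close>

lemma dcl_expand:
  assumes "A \<subseteq> univ M"
  shows "dcl (expand M A) C = dcl M (A \<union> C)"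
proof
  show "dcl M (A \<union> C) \<subseteq> dcl (expand M A) C"
    using dcl_subset_dcl_expand[of M "A \<union> C" A] dcl_Un_dcl_empty[OF constants_in_dcl_empty[OF assms]]
    by simp
qed (rule dcl_expand_subset)

section \<open>Rigidity over a set\<close>

lemma automorphism_expand:
  "automorphism (expand M A) h \<longleftrightarrow> automorphism M h \<and> (\<forall>a\<in>A. h a = a)"
proof -
  have "tuples X 0 = {[]}" for X :: "'b set" by (auto simp: tuples_def)
  then show ?thesis by (auto simp: automorphism_def ball_Un)
qed

lemma rigid_over_expand:
  assumes "A \<subseteq> univ M"
  shows "rigid_over s (expand M A) C = rigid_over s M (A \<union> C)"
proof (cases s)
  case Sem
  then show ?thesis by (auto simp: sem_rigid_def automorphism_expand)
next
  case Synt
  then show ?thesis by (simp add: synt_rigid_def dcl_expand[OF assms])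
qed

lemma rigid_over_mono:
  assumes "rigid_over s M X" "X \<subseteq> Y"
  shows "rigid_over s M Y"
proof (cases s)
  case Sem
  then show ?thesis using assms by (auto simp: sem_rigid_def)
next
  case Synt
  then show ?thesis
    using assms dcl_mono[OF assms(2), of M] by (auto simp: synt_rigid_def dcl_def)
qed

lemma rigid_over_univ: "rigid_over s M (univ M)"
proof (cases s)
  case Sem
  then show ?thesis by (simp add: sem_rigid_def)
next
  case Synt
  have "b \<in> dcl M (univ M)" if "b \<in> univ M" for b
    using that unfolding dcl_def definable_def
    by (auto intro!: exI[of _ "Eq (Var 0) (Var 1)"] exI[of _ "\<lambda>_. b"])
  then show ?thesis using Synt by (auto simp: synt_rigid_def dcl_def)
qed

lemma rigid_over_Un_dcl_empty:
  assumes "is_struct M" "A \<subseteq> dcl M {}"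
  shows "rigid_over s M (A \<union> C) = rigid_over s M C"
proof (cases s)
  case Sem
  have "h a = a" if "automorphism M h" "a \<in> A" for h a
    using automorphism_fixes_dcl_empty[OF assms(1) that(1)] that(2) assms(2) by blast
  then show ?thesis using Sem by (auto simp: sem_rigid_def)
next
  case Synt
  then show ?thesis by (simp add: synt_rigid_def dcl_Un_dcl_empty[OF assms(2)])
qed

section \<open>Degrees of rigidity\<close>

lemma n_rigid_rigid_over_mono:
  assumes "univ M = univ N" "\<And>C. rigid_over s M C \<Longrightarrow> rigid_over s N C"
  shows "n_rigid Q s M n \<Longrightarrow> n_rigid Q s N n"
  using assms by (cases Q) auto

lemma deg_rig_le: "n_rigid Q s M n \<Longrightarrow> deg_rig Q s M \<le> enat n"
  by (auto simp: deg_rig_def intro: Least_le)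

lemma deg_rig_attained: "deg_rig Q s M = enat n \<Longrightarrow> n_rigid Q s M n"
  by (auto simp: deg_rig_def split: if_splits intro: LeastI)

lemma deg_rig_antimono:
  assumes "univ M = univ N" "\<And>C. rigid_over s M C \<Longrightarrow> rigid_over s N C"
  shows "deg_rig Q s N \<le> deg_rig Q s M"
proof (cases "deg_rig Q s M")
  case (enat n)
  then show ?thesis
    using deg_rig_le n_rigid_rigid_over_mono[OF assms] deg_rig_attained by metis
qed simp

lemma deg_rig_over_exists_le:
  assumes "A \<subseteq> univ M" "C \<subseteq> univ M" "finite C" "rigid_over s M (A \<union> C)"
  shows "deg_rig_over QExists s M A \<le> enat (card C)"
  unfolding deg_rig_over_def
  by (rule deg_rig_le) (use assms rigid_over_expand[OF assms(1)] in auto)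

lemma deg_rig_over_exists_cofinite:
  assumes "A \<subseteq> univ M" "finite (univ M - A)"
  shows "\<exists>m. deg_rig_over QExists s M A = enat m"
proof -
  have "A \<union> (univ M - A) = univ M" using assms(1) by auto
  then have "deg_rig_over QExists s M A \<le> enat (card (univ M - A))"
    using assms rigid_over_univ[of s M] by (intro deg_rig_over_exists_le) auto
  then show ?thesis by (auto dest: enat_ile)
qed

text \<open>
  A set \<open>C\<close> of fewer than \<open>card (W - A')\<close> elements cannot make \<open>A' \<union> C\<close> sufficient for rigidity, as
  that set would be smaller than \<open>W\<close>.
\<close>

lemma deg_rig_over_subset_of_witness:
  assumes W: "witnesses s M W" and "A' \<subseteq> W"
  shows "deg_rig_over QExists s M A' = enat (card (W - A'))"
proof (rule antisym)
  have univ: "W \<subseteq> univ M" and fin: "finite W" and deg: "deg_rig QExists s M = enat (card W)"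
    and rig: "rigid_over s M W"
    using W by (auto simp: witnesses_def)
  have A': "A' \<subseteq> univ M" "finite A'" using univ fin \<open>A' \<subseteq> W\<close> finite_subset by auto
  have "A' \<union> (W - A') = W" using \<open>A' \<subseteq> W\<close> by auto
  then show le: "deg_rig_over QExists s M A' \<le> enat (card (W - A'))"
    using A' univ fin rig by (intro deg_rig_over_exists_le) auto
  then obtain n where n: "deg_rig_over QExists s M A' = enat n" by (auto dest: enat_ile)
  then obtain C where C: "C \<subseteq> univ M" "finite C" "card C = n" "rigid_over s M (A' \<union> C)"
    using deg_rig_attained[of QExists s "expand M A'" n] rigid_over_expand[OF A'(1)]
    by (auto simp: deg_rig_over_def)
  have "n_rigid QExists s M (card (A' \<union> C))"
    unfolding n_rigid.simps by (rule exI[of _ "A' \<union> C"]) (use C A' in auto)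
  then have "card W \<le> card (A' \<union> C)" using deg_rig_le deg by fastforce
  also have "\<dots> \<le> card A' + n" using card_Un_le[of A' C] C(3) by simp
  finally show "enat (card (W - A')) \<le> deg_rig_over QExists s M A'"
    using n card_Diff_subset[OF A'(2) \<open>A' \<subseteq> W\<close>] by simp
qed

lemma ex_minimal_rigid_ext:
  assumes "A \<subseteq> univ M" "finite (univ M - A)"
  shows "\<exists>A'. minimal_rigid_ext s M A A'"
proof -
  let ?F = "{X. A \<subseteq> X \<and> X \<subseteq> univ M \<and> rigid_over s M X}"
  have "inj_on (\<lambda>X. X - A) ?F" by (auto simp: inj_on_def)
  moreover have "(\<lambda>X. X - A) ` ?F \<subseteq> Pow (univ M - A)" by auto
  ultimately have "finite ?F" using assms(2) by (meson finite_Pow_iff inj_on_finite)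
  moreover have "univ M \<in> ?F" using assms(1) rigid_over_univ by auto
  ultimately obtain A' where A': "A' \<in> ?F" and min: "\<forall>X\<in>?F. X \<subseteq> A' \<longrightarrow> A' = X"
    by (metis (no_types, lifting) finite_has_minimal empty_iff)
  have "finite (A' - A)" using A' by (intro finite_subset[OF _ assms(2)]) auto
  moreover have "\<not> rigid s (expand M X)" if "A \<subseteq> X" "X \<subset> A'" for X
  proof -
    have "X \<subseteq> univ M" using that A' by auto
    then show ?thesis using that min rigid_over_expand[of X M s "{}"] by auto
  qed
  ultimately show ?thesis
    using A' rigid_over_expand[of A' M s "{}"] unfolding minimal_rigid_ext_def by auto
qed

theorem proposition2p11:
  fixes M :: "('f, 'r, 'a) fo_struct"
    and A :: "'a set"
    and Q :: rig_quant
    and s :: rig_mode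
  assumes "is_struct M"
    and "A \<subseteq> univ M"
  shows
    "(A \<subseteq> dcl M {} \<longrightarrow> deg_rig Q s M = deg_rig_over Q s M A) \<and>
     ((\<exists>W\<subseteq>A. witnesses s M W) \<longrightarrow> deg_rig_over QExists s M A = 0) \<and>
     (\<forall>B. A \<subseteq> B \<and> B \<subseteq> univ M \<longrightarrow> deg_rig_over Q s M A \<ge> deg_rig_over Q s M B) \<and>
     (witnesses s M A \<longrightarrow>
       (\<forall>A'\<subseteq>A. deg_rig QExists s M
                 = deg_rig_over QExists s M A' + deg_rig_over QExists s M (A - A'))) \<and>
     (finite (univ M - A) \<longrightarrow>
       (\<exists>m. deg_rig_over QExists Sem M A = enat m) \<and>
       (\<exists>n. deg_rig_over QExists Synt M A = enat n)) \<and>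
     (finite (univ M - A) \<longrightarrow> (\<exists>A'. minimal_rigid_ext s M A A'))"
proof (intro conjI impI allI)
  assume "A \<subseteq> dcl M {}"
  then have "rigid_over s (expand M A) C = rigid_over s M C" for C
    using rigid_over_expand[OF assms(2)] rigid_over_Un_dcl_empty[OF assms(1)] by simp
  then show "deg_rig Q s M = deg_rig_over Q s M A"
    unfolding deg_rig_over_def by (intro antisym deg_rig_antimono) simp_all
next
  assume "\<exists>W\<subseteq>A. witnesses s M W"
  then have "rigid_over s M (A \<union> {})" by (auto simp: witnesses_def intro: rigid_over_mono)
  then have "deg_rig_over QExists s M A \<le> enat (card ({} :: 'a set))"
    using assms(2) by (intro deg_rig_over_exists_le) auto
  then show "deg_rig_over QExists s M A = 0" by (simp add: zero_enat_def[symmetric])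
next
  fix B assume B: "A \<subseteq> B \<and> B \<subseteq> univ M"
  have "rigid_over s (expand M B) C" if "rigid_over s (expand M A) C" for C
  proof -
    have "rigid_over s M (A \<union> C)" using that rigid_over_expand[OF assms(2)] by blast
    then have "rigid_over s M (B \<union> C)" by (rule rigid_over_mono) (use B in auto)
    then show ?thesis using rigid_over_expand[of B M] B by blast
  qed
  then show "deg_rig_over Q s M B \<le> deg_rig_over Q s M A"
    unfolding deg_rig_over_def by (intro deg_rig_antimono) simp_all
next
  fix A' assume W: "witnesses s M A" and "A' \<subseteq> A"
  then have "finite A" "deg_rig QExists s M = enat (card A)" by (auto simp: witnesses_def)
  moreover have "deg_rig_over QExists s M A' = enat (card (A - A'))"
    using deg_rig_over_subset_of_witness[OF W \<open>A' \<subseteq> A\<close>] .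
  moreover have "deg_rig_over QExists s M (A - A') = enat (card A')"
    using deg_rig_over_subset_of_witness[OF W, of "A - A'"] \<open>A' \<subseteq> A\<close>
    by (simp add: double_diff)
  moreover have "card A = card (A - A') + card A'"
    using \<open>finite A\<close> \<open>A' \<subseteq> A\<close>
    by (metis card_Diff_subset card_mono finite_subset le_add_diff_inverse2)
  ultimately show "deg_rig QExists s M
      = deg_rig_over QExists s M A' + deg_rig_over QExists s M (A - A')" by simp
qed (use deg_rig_over_exists_cofinite[OF assms(2)] ex_minimal_rigid_ext[OF assms(2)] in auto)

end
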